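(* Let $G$ be a nontrivial connected graph with diameter $d$ and let $G^u$ be a rooted graph on $G$. Then $$\dim(G^u\sqcap P_n^0)\leq\dim(G^u\sqcap P_{n+1}^0)\quad\text{for } 1\leq n\leq d-1,$$ $$\dim(G^u\sqcap P_n^0)=\dim(G^u\sqcap P_{n+1}^0)\quad\text{for } n\geq d.$$
   Context: All graphs are finite, simple and connected; the graph $G$ is nontrivial (at least two vertices). For a graph $H$, $d_H(u,v)$ is the distance between $u$ and $v$, and $R_H\{u,v\}=\{w\in V(H) : d_H(u,w)\neq d_H(v,w)\}$. A subset $W\subseteq V(H)$ is a resolving set of $H$ if $W\cap R_H\{u,v\}\neq\emptyset$ for any two distinct vertices $u,v$ of $H$. The metric dimension $\dim(H)$ is the minimum cardinality of a resolving set of $H$. A rooted graph $G^u$ is a graph $G$ with a distinguished vertex $u$, its root. The hierarchical product $G_2^{u_2}\sqcap G_1^{u_1}$ of rooted graphs is the rooted graph with vertex set $\{x_2x_1 : x_i\in V(G_i), i=1,2\}$ (pairs), root $u_2u_1$, in which $x_2x_1$ is adjacent to $y_2y_1$ whenever $x_2=y_2$ and $\{x_1,y_1\}\in E(G_1)$, or $x_1=y_1=u_1$ and $\{x_2,y_2\}\in E(G_2)$. The metric dimension of a rooted graph is that of the underlying graph. $P_n$ denotes the path on $n$ vertices $z_0=0,z_1,\ldots,z_{n-1}$ (with $z_i$ adjacent to $z_{i+1}$), and $0$ is one of its end-vertices; $P_n^0$ is $P_n$ rooted at $0$. For $n=1$, $P_1$ is a single vertex and $G^u\sqcap P_1^0$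 is isomorphic to $G^u$. *)

theory Defs
  imports "Graph_Theory.Graph_Theory"
begin

text \<open>
  A finite simple graph is a \<open>pair_graph\<close>: a finite vertex set together with a symmetric,
  irreflexive arc relation on it.  An undirected edge is thus the pair of its two arcs.
\<close>

definition gdist :: "'a pair_pre_digraph \<Rightarrow> 'a \<Rightarrow> 'a \<Rightarrow> nat" where
  "gdist H u v = (LEAST k. \<exists>p. pre_digraph.awalk (with_proj H) u p v \<and> length p = k)"

text \<open>
  On connected graphs, \<open>gdist\<close> is the library's shortest-path cost \<open>\<mu>\<close> for unit weights, taken
  as a natural number.  The value of \<open>gdist\<close> is meaningless if \<open>v\<close> is not reachable from \<open>u\<close>.
\<close>

lemma gdist_eq_\<mu>:
  assumes "pair_wf_digraph H" "u \<rightarrow>\<^sup>*\<^bsub>with_proj H\<^esub> v"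
  shows "wf_digraph.\<mu> (with_proj H) (\<lambda>_. 1) u v = ereal (real (gdist H u v))"
proof -
  interpret pair_wf_digraph H by fact
  have cost: "awalk_cost (\<lambda>_. 1) p = real (length p)" for p :: "('a \<times> 'a) list"
    by (induct p) auto
  let ?P = "\<lambda>k. \<exists>p. awalk u p v \<and> length p = k"
  obtain q where "awalk u q v" using assms(2) by (auto simp: reachable_awalk)
  then have ex: "?P (length q)" by blast
  obtain p where p: "awalk u p v" "length p = gdist H u v"
    using LeastI[of ?P, OF ex] unfolding gdist_def by blast
  have le: "gdist H u v \<le> length r" if "awalk u r v" for r
    unfolding gdist_def by (rule Least_le) (use that in blast)
  show ?thesis
    unfolding \<mu>_def cost
  proof (rule INF_eqI)
    show "ereal (real (gdist H u v)) \<le> ereal (real (length r))" if "r \<in> {p. awalk u p v}" for r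
      using le that by simp
    show "y \<le> ereal (real (gdist H u v))"
      if "\<And>r. r \<in> {p. awalk u p v} \<Longrightarrow> y \<le> ereal (real (length r))" for y
      using that[of p] p by simp
  qed
qed

definition diameter :: "'a pair_pre_digraph \<Rightarrow> nat" where
  "diameter H = Max {gdist H u v | u v. u \<in> pverts H \<and> v \<in> pverts H}"

definition resolvers :: "'a pair_pre_digraph \<Rightarrow> 'a \<Rightarrow> 'a \<Rightarrow> 'a set" where
  "resolvers H u v = {w \<in> pverts H. gdist H u w \<noteq> gdist H v w}"

definition resolving_set :: "'a pair_pre_digraph \<Rightarrow> 'a set \<Rightarrow> bool" where
  "resolving_set H W \<longleftrightarrow> W \<subseteq> pverts H \<and>
     (\<forall>u\<in>pverts H. \<forall>v\<in>pverts H. u \<noteq> v \<longrightarrow> W \<inter> resolvers H u v \<noteq> {})"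

definition metric_dim :: "'a pair_pre_digraph \<Rightarrow> nat" where
  "metric_dim H = (LEAST k. \<exists>W. resolving_set H W \<and> card W = k)"

text \<open>A rooted graph is a pair of a graph and its root.\<close>

type_synonym 'a rooted_graph = "'a pair_pre_digraph \<times> 'a"

definition rooted_metric_dim :: "'a rooted_graph \<Rightarrow> nat" where
  "rooted_metric_dim R = metric_dim (fst R)"

fun hierarchical_product :: "'a rooted_graph \<Rightarrow> 'b rooted_graph \<Rightarrow> ('a \<times> 'b) rooted_graph"
    (infixl \<open>\<sqinter>\<^sub>h\<close> 70) where
  "(G2, u2) \<sqinter>\<^sub>h (G1, u1) =
     (\<lparr> pverts = pverts G2 \<times> pverts G1,
        parcs = {((x2, x1), (y2, y1)).
                   (x2, x1) \<in> pverts G2 \<times> pverts G1 \<and> (y2, y1) \<in> pverts G2 \<times> pverts G1 \<and>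
                   (x2 = y2 \<and> (x1, y1) \<in> parcs G1 \<or>
                    x1 = u1 \<and> y1 = u1 \<and> (x2, y2) \<in> parcs G2)} \<rparr>,
      (u2, u1))"

definition path_graph :: "nat \<Rightarrow> nat pair_pre_digraph" where
  "path_graph n =
     \<lparr> pverts = {..<n},
       parcs = {(i, j). i < n \<and> j < n \<and> (j = Suc i \<or> i = Suc j)} \<rparr>"

lemma pair_graph_path_graph: "pair_graph (path_graph n)"
proof -
  have "finite (parcs (path_graph n))"
    by (rule finite_subset[of _ "{..<n} \<times> {..<n}"]) (auto simp: path_graph_def)
  then show ?thesis
    by unfold_locales (auto simp: path_graph_def symmetric_def intro!: symI)
qed

lemma pair_graph_hierarchical_product:
  assumes "pair_graph G2" "pair_graph G1"
  shows "pair_graph (fst ((G2, u2) \<sqinter>\<^sub>h (G1, u1)))"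
proof -
  interpret G2: pair_graph G2 by fact
  interpret G1: pair_graph G1 by fact
  let ?H = "fst ((G2, u2) \<sqinter>\<^sub>h (G1, u1))"
  have fin: "finite (pverts ?H)" using G2.pair_finite_verts G1.pair_finite_verts by simp
  have "finite (parcs ?H)"
    by (rule finite_subset[OF _ finite_cartesian_product[OF fin fin]]) auto
  moreover have "sym (parcs G1)" "sym (parcs G2)"
    using G1.pair_sym_arcs G2.pair_sym_arcs by (auto simp: symmetric_def)
  ultimately show ?thesis
    using fin G1.no_loops' G2.no_loops'
    by unfold_locales (auto simp: symmetric_def intro!: symI dest: symD)
qed

end

theory Submission
  imports Defs
begin

text \<open>
  In \<open>(G, u) \<sqinter>\<^sub>h (path_graph n, 0)\<close> a path with \<open>n\<close> vertices hangs at every vertex of \<open>G\<close>, and the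
  distance of \<open>(a, i)\<close> and \<open>(b, j)\<close> is \<open>\<bar>i - j\<bar>\<close> if \<open>a = b\<close> and \<open>gdist G a b + i + j\<close> otherwise.
  Hence all landmarks on one hanging path give the same information on two vertices outside
  that path, while the landmark at its far end tells each vertex of the path from every other
  vertex of the product.  A landmark may therefore be pushed to the far end of its path, and only
  the set \<open>S\<close> of vertices of \<open>G\<close> whose path carries a landmark matters: it must be nonempty, and
  for distinct \<open>a, b \<notin> S\<close> the values \<open>gdist G a s - gdist G b s\<close>, for \<open>s \<in> S\<close>, must not all be
  equal to one number \<open>j - i\<close> with \<open>i, j < n\<close>.  So the metric dimension of the product is the
  least size of such a set (\<open>metric_dim_product_eq_Least\<close>).

  The condition on \<open>S\<close> becomes stronger as \<open>n\<close> grows, which gives the inequality.  In passing from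
  \<open>n\<close> to \<open>n + 1\<close> the only new values for the common difference are \<open>n\<close> and \<open>-n\<close>.  As
  \<open>S\<close> contains neither \<open>a\<close> nor \<open>b\<close>, both distances lie between \<open>1\<close> and the diameter \<open>d\<close>, so they
  differ by less than \<open>d\<close>; for \<open>n \<ge> d\<close> the condition is the same for \<open>n\<close> and \<open>n + 1\<close>.
\<close>

section \<open>Distances in graphs\<close>

lemma gdist_le_length:
  assumes "pre_digraph.awalk (with_proj H) x p v"
  shows "gdist H x v \<le> length p"
  unfolding gdist_def by (rule Least_le) (use assms in blast)

lemma gdist_self:
  assumes "pair_wf_digraph H" "v \<in> pverts H"
  shows "gdist H v v = 0"
proof -
  interpret pair_wf_digraph H by fact
  have "awalk v [] v" using assms(2) by (simp add: awalk_Nil_iff)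
  from gdist_le_length[OF this] show ?thesis by simp
qed

lemma shortest_awalk:
  assumes "pair_wf_digraph H" "x \<rightarrow>\<^sup>*\<^bsub>with_proj H\<^esub> v"
  obtains p where "pre_digraph.awalk (with_proj H) x p v" "length p = gdist H x v"
proof -
  interpret pair_wf_digraph H by fact
  let ?P = "\<lambda>k. \<exists>p. awalk x p v \<and> length p = k"
  obtain q where "awalk x q v" using assms(2) by (auto simp: reachable_awalk)
  then have "?P (length q)" by blast
  then have "?P (gdist H x v)" unfolding gdist_def by (rule LeastI[of ?P])
  then show thesis using that by blast
qed

lemma gdist_arc_le:
  assumes "pair_wf_digraph H" "(x, y) \<in> parcs H" "y \<rightarrow>\<^sup>*\<^bsub>with_proj H\<^esub> v"
  shows "gdist H x v \<le> Suc (gdist H y v)"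
proof -
  interpret pair_wf_digraph H by fact
  obtain p where p: "awalk y p v" "length p = gdist H y v"
    using shortest_awalk[OF assms(1,3)] .
  then have "awalk x ((x, y) # p) v"
    using assms(2) by (simp add: awalk_Cons_iff)
  from gdist_le_length[OF this] show ?thesis using p by simp
qed

lemma gdist_descent:
  assumes "pair_wf_digraph H" "x \<rightarrow>\<^sup>*\<^bsub>with_proj H\<^esub> v" "x \<noteq> v"
  obtains y where "(x, y) \<in> parcs H" "gdist H x v = Suc (gdist H y v)"
proof -
  interpret pair_wf_digraph H by fact
  obtain p where p: "awalk x p v" "length p = gdist H x v"
    using shortest_awalk[OF assms(1,2)] .
  then obtain e es where [simp]: "p = e # es"
    using assms(3) by (cases p) (auto simp: awalk_Nil_iff)
  define y where "y = snd e"
  have e: "(x, y) \<in> parcs H" and es: "awalk y es v"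
    using p(1) by (auto simp: awalk_Cons_iff y_def)
  have "y \<rightarrow>\<^sup>*\<^bsub>with_proj H\<^esub> v" using es by (auto simp: reachable_awalk)
  from gdist_arc_le[OF assms(1) e this] gdist_le_length[OF es] p(2)
  have "gdist H x v = Suc (gdist H y v)" by simp
  with e show thesis using that by blast
qed

lemma gdist_pos:
  assumes "pair_wf_digraph H" "x \<rightarrow>\<^sup>*\<^bsub>with_proj H\<^esub> v" "x \<noteq> v"
  shows "0 < gdist H x v"
  using gdist_descent[OF assms] by (metis zero_less_Suc)

text \<open>
  Along an arc a potential \<open>f\<close> drops by at most \<open>1\<close>, so a walk to \<open>v\<close> has at least \<open>f x\<close> arcs;
  following arcs on which it drops by exactly \<open>1\<close> gives a walk with \<open>f x\<close> arcs.  This computes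
  distances without reasoning about the shape of shortest walks.
\<close>

lemma gdist_eq_potential:
  assumes "pair_wf_digraph H" "v \<in> pverts H" "x \<in> pverts H"
    and zero: "\<And>x. x \<in> pverts H \<Longrightarrow> f x = 0 \<longleftrightarrow> x = v"
    and arc: "\<And>x y. (x, y) \<in> parcs H \<Longrightarrow> f x \<le> Suc (f y)"
    and descent: "\<And>x. x \<in> pverts H \<Longrightarrow> x \<noteq> v \<Longrightarrow> \<exists>y. (x, y) \<in> parcs H \<and> f x = Suc (f y)"
  shows "gdist H x v = f x"
proof -
  interpret pair_wf_digraph H by fact
  have lower: "f x \<le> length p" if "awalk x p v" for x p
    using that
  proof (induction p arbitrary: x)
    case Nil
    then show ?case using zero[of v] assms(2) by (auto simp: awalk_Nil_iff)
  next
    case (Cons e p)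
    obtain y where "(x, y) \<in> parcs H" "awalk y p v"
      using Cons.prems by (cases e) (auto simp: awalk_Cons_iff)
    with Cons.IH arc show ?case by fastforce
  qed
  have upper: "\<exists>p. awalk x p v \<and> length p = f x" if "x \<in> pverts H" for x
    using that
  proof (induction "f x" arbitrary: x)
    case 0
    then have "awalk x [] v" using zero[of x] by (auto simp: awalk_Nil_iff)
    then show ?case using 0 by auto
  next
    case (Suc k)
    then obtain y where y: "(x, y) \<in> parcs H" "f x = Suc (f y)"
      using descent[of x] zero[of x] by auto
    then have "y \<in> pverts H" using in_arcsD2 by blast
    then obtain p where "awalk y p v" "length p = f y"
      using Suc.hyps y by auto
    then have "awalk x ((x, y) # p) v" "length ((x, y) # p) = f x"
      using y by (simp_all add: awalk_Cons_iff)
    then show ?case by blast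
  qed
  obtain p where p: "awalk x p v" "length p = f x" using upper assms(3) by blast
  then have "x \<rightarrow>\<^sup>*\<^bsub>with_proj H\<^esub> v" by (auto simp: reachable_awalk)
  from shortest_awalk[OF assms(1) this] obtain q where "awalk x q v" "length q = gdist H x v" .
  with lower have "f x \<le> gdist H x v" by metis
  with gdist_le_length[OF p(1)] p(2) show ?thesis by simp
qed

lemma gdist_le_diameter:
  assumes "finite (pverts H)" "x \<in> pverts H" "y \<in> pverts H"
  shows "gdist H x y \<le> diameter H"
proof -
  have "{gdist H u v | u v. u \<in> pverts H \<and> v \<in> pverts H}
      = (\<lambda>(u, v). gdist H u v) ` (pverts H \<times> pverts H)" by auto
  then have "finite {gdist H u v | u v. u \<in> pverts H \<and> v \<in> pverts H}"
    using assms(1) by simp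
  then show ?thesis unfolding diameter_def using assms(2,3) by (intro Max_ge) auto
qed

section \<open>Distances in the product with a path\<close>

abbreviation path_product :: "'a pair_pre_digraph \<Rightarrow> 'a \<Rightarrow> nat \<Rightarrow> ('a \<times> nat) pair_pre_digraph" where
  "path_product G u n \<equiv> fst ((G, u) \<sqinter>\<^sub>h (path_graph n, 0))"

declare hierarchical_product.simps [simp del]

lemma pverts_path_product: "pverts (path_product G u n) = pverts G \<times> {..<n}"
  by (simp add: hierarchical_product.simps path_graph_def)

lemma parcs_path_product:
  "((x, i), (y, j)) \<in> parcs (path_product G u n) \<longleftrightarrow>
     x \<in> pverts G \<and> y \<in> pverts G \<and> i < n \<and> j < n \<and>
     (x = y \<and> (j = Suc i \<or> i = Suc j) \<or> i = 0 \<and> j = 0 \<and> (x, y) \<in> parcs G)"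
  by (auto simp: hierarchical_product.simps path_graph_def)

locale connected_pair_graph = pair_graph G for G :: "'a pair_pre_digraph" +
  assumes connected_G: "Digraph_Component.connected (with_proj G)"
begin

lemma reachable_in: "x \<in> pverts G \<Longrightarrow> y \<in> pverts G \<Longrightarrow> x \<rightarrow>\<^sup>*\<^bsub>with_proj G\<^esub> y"
  using symmetric_connected_imp_strongly_connected[OF sym_arcs connected_G]
  by (auto simp: strongly_connected_def)

lemma wf: "pair_wf_digraph G" ..

text \<open>
  In natural numbers \<open>(i - j) + (j - i)\<close> is \<open>\<bar>i - j\<bar>\<close>.  The formula holds because it is a potential
  for the target \<open>(b, j)\<close>: outside the path at \<open>b\<close> it drops on the way to height \<open>0\<close> and then
  along shortest walks of \<open>G\<close>, and on that path it drops towards \<open>j\<close>.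
\<close>

lemma gdist_product:
  assumes "a \<in> pverts G" "b \<in> pverts G" "i < n" "j < n"
  shows "gdist (path_product G u n) (a, i) (b, j) =
    (if a = b then (i - j) + (j - i) else gdist G a b + i + j)"
proof -
  let ?H = "path_product G u n"
  define f where "f = (\<lambda>(x, k). if x = b then (k - j) + (j - k) else gdist G x b + k + j)"
  have pos: "0 < gdist G x b" if "x \<in> pverts G" "x \<noteq> b" for x
    using gdist_pos[OF wf reachable_in] that assms by blast
  have "gdist ?H (a, i) (b, j) = f (a, i)"
  proof (rule gdist_eq_potential)
    have "pair_graph ?H"
      by (intro pair_graph_hierarchical_product pair_graph_path_graph pair_graph_axioms)
    then interpret H: pair_graph ?H .
    show "pair_wf_digraph ?H" ..
    show "(b, j) \<in> pverts ?H" "(a, i) \<in> pverts ?H"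
      using assms by (simp_all add: pverts_path_product)
    show "f x = 0 \<longleftrightarrow> x = (b, j)" if "x \<in> pverts ?H" for x
      using that pos
      by (cases x) (auto simp: f_def pverts_path_product)
    show "f x \<le> Suc (f y)" if "(x, y) \<in> parcs ?H" for x y
    proof -
      obtain x' k y' l where xy: "x = (x', k)" "y = (y', l)" by fastforce
      have arc_le: "gdist G x' b \<le> Suc (gdist G y' b)" if "(x', y') \<in> parcs G"
        using gdist_arc_le[OF wf that] reachable_in that assms in_arcsD2 by blast
      show ?thesis
        using that arc_le gdist_self[OF wf assms(2)]
        unfolding xy parcs_path_product f_def by auto
    qed
    show "\<exists>y. (x, y) \<in> parcs ?H \<and> f x = Suc (f y)" if x: "x \<in> pverts ?H" "x \<noteq> (b, j)" for x
    proof -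
      obtain x' k where [simp]: "x = (x', k)" by fastforce
      have x': "x' \<in> pverts G" "k < n" using x(1) by (simp_all add: pverts_path_product)
      consider "x' = b" "k < j" | "x' = b" "j < k" | "x' \<noteq> b" "0 < k" | "x' \<noteq> b" "k = 0"
        using x(2) by fastforce
      then show ?thesis
      proof cases
        case 1
        then show ?thesis using x' assms
          by (intro exI[of _ "(b, Suc k)"]) (simp add: parcs_path_product f_def)
      next
        case 2
        then show ?thesis using x' assms
          by (intro exI[of _ "(b, k - 1)"]) (auto simp: parcs_path_product f_def)
      next
        case 3
        then show ?thesis using x' assms
          by (intro exI[of _ "(x', k - 1)"]) (auto simp: parcs_path_product f_def)
      next
        case 4
        obtain y where y: "(x', y) \<in> parcs G" "gdist G x' b = Suc (gdist G y b)"
          using gdist_descent[OF wf reachable_in] x'(1) assms(2) 4(1) by metis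
        then have "y \<in> pverts G" using in_arcsD2 by blast
        then show ?thesis using 4 y x' assms gdist_self[OF wf assms(2)]
          by (intro exI[of _ "(y, 0)"]) (auto simp: parcs_path_product f_def)
      qed
    qed
  qed
  then show ?thesis by (simp add: f_def)
qed

section \<open>Landmark fibres\<close>

text \<open>
  This says when landmarks at the far ends of the paths over \<open>S\<close> resolve the product: paths that
  carry a landmark need no condition, and nonemptiness is what two vertices on one path
  without landmark need.
\<close>

definition resolving_fibres :: "nat \<Rightarrow> 'a set \<Rightarrow> bool" where
  "resolving_fibres n S \<longleftrightarrow> S \<subseteq> pverts G \<and> S \<noteq> {} \<and>
     (\<forall>a\<in>pverts G - S. \<forall>b\<in>pverts G - S. a \<noteq> b \<longrightarrow>
       (\<forall>i<n. \<forall>j<n. \<exists>s\<in>S. gdist G a s + i \<noteq> gdist G b s + j))"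

text \<open>
  For vertices outside the paths with landmarks, the height of a landmark is added to both
  distances and cancels.
\<close>

lemma resolving_set_fibres:
  assumes "2 \<le> card (pverts G)" "1 \<le> n" "resolving_set (path_product G u n) W"
  shows "resolving_fibres n (fst ` W)"
proof -
  note W = assms(3)[unfolded resolving_set_def resolvers_def pverts_path_product]
  have resolved: "\<exists>w\<in>W. gdist (path_product G u n) (a, i) w \<noteq> gdist (path_product G u n) (b, j) w"
    if "a \<in> pverts G" "b \<in> pverts G" "i < n" "j < n" "(a, i) \<noteq> (b, j)" for a b i j
    using W that by blast
  obtain a b where "a \<in> pverts G" "b \<in> pverts G" "a \<noteq> b"
    using assms(1) by (auto simp: numeral_2_eq_2 card_le_Suc_iff)
  then have "W \<noteq> {}" using resolved[of a b 0 0] assms(2) by auto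
  moreover have "\<exists>s\<in>fst ` W. gdist G a s + i \<noteq> gdist G b s + j"
    if ab: "a \<in> pverts G - fst ` W" "b \<in> pverts G - fst ` W" "a \<noteq> b" "i < n" "j < n" for a b i j
  proof -
    obtain s k where w: "(s, k) \<in> W"
      "gdist (path_product G u n) (a, i) (s, k) \<noteq> gdist (path_product G u n) (b, j) (s, k)"
      using resolved[of a b i j] ab by auto
    have "W \<subseteq> pverts G \<times> {..<n}" using W by simp
    with w(1) have "s \<in> pverts G" "k < n" "s \<in> fst ` W" by force+
    moreover from this ab have "s \<noteq> a" "s \<noteq> b" by auto
    ultimately show ?thesis using w(2) ab by (auto simp: gdist_product)
  qed
  moreover have "fst ` W \<subseteq> pverts G" using W by auto
  ultimately show ?thesis unfolding resolving_fibres_def by blast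
qed

text \<open>
  Inside its own path the far end is at distance at most \<open>n - 1\<close>, and the distances are distinct;
  every vertex outside the path is farther away.
\<close>

lemma resolving_fibres_far_ends:
  assumes "1 \<le> n" "resolving_fibres n S"
  shows "resolving_set (path_product G u n) (S \<times> {n - 1})"
proof -
  let ?H = "path_product G u n"
  note S = assms(2)[unfolded resolving_fibres_def]
  have pos: "0 < gdist G x s" if "x \<in> pverts G" "s \<in> S" "x \<noteq> s" for x s
    using gdist_pos[OF wf reachable_in] that S by blast
  have resolved: "\<exists>s\<in>S. gdist ?H (a, i) (s, n - 1) \<noteq> gdist ?H (b, j) (s, n - 1)"
    if ab: "a \<in> pverts G" "b \<in> pverts G" "i < n" "j < n" "(a, i) \<noteq> (b, j)" for a b i j
  proof -
    consider "a \<in> S" | "b \<in> S" | "a \<notin> S" "b \<notin> S" "a = b" | "a \<notin> S" "b \<notin> S" "a \<noteq> b" by blast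
    then show ?thesis
    proof cases
      case 1
      then show ?thesis using ab pos[of b a] assms(1)
        by (intro bexI[of _ a]) (auto simp: gdist_product)
    next
      case 2
      then show ?thesis using ab pos[of a b] assms(1)
        by (intro bexI[of _ b]) (auto simp: gdist_product)
    next
      case 3
      obtain s where "s \<in> S" using S by blast
      moreover from this 3 S have "s \<in> pverts G" "s \<noteq> a" by auto
      ultimately show ?thesis using 3 ab assms(1)
        by (intro bexI[of _ s]) (auto simp: gdist_product)
    next
      case 4
      then obtain s where s: "s \<in> S" "gdist G a s + i \<noteq> gdist G b s + j" using S ab by blast
      moreover from this 4 S have "s \<in> pverts G" "s \<noteq> a" "s \<noteq> b" by auto
      ultimately show ?thesis using ab assms(1)
        by (intro bexI[of _ s]) (auto simp: gdist_product)
    qed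
  qed
  have "S \<times> {n - 1} \<subseteq> pverts ?H"
    using S assms(1) by (auto simp: pverts_path_product)
  moreover have "(S \<times> {n - 1}) \<inter> resolvers ?H x y \<noteq> {}"
    if xy: "x \<in> pverts ?H" "y \<in> pverts ?H" "x \<noteq> y" for x y
  proof -
    obtain s where "s \<in> S" "gdist ?H x (s, n - 1) \<noteq> gdist ?H y (s, n - 1)"
      using resolved[of "fst x" "fst y" "snd x" "snd y"] xy
      by (auto simp: pverts_path_product prod_eq_iff)
    then show ?thesis
      using \<open>S \<times> {n - 1} \<subseteq> pverts ?H\<close> unfolding resolvers_def by auto
  qed
  ultimately show ?thesis unfolding resolving_set_def by blast
qed

lemma resolving_fibres_pverts:
  assumes "pverts G \<noteq> {}"
  shows "resolving_fibres n (pverts G)"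
  using assms by (simp add: resolving_fibres_def)

lemma metric_dim_product_eq_Least:
  assumes "2 \<le> card (pverts G)" "1 \<le> n"
  shows "metric_dim (path_product G u n) = (LEAST k. \<exists>S. resolving_fibres n S \<and> card S = k)"
    (is "_ = (LEAST k. ?P k)")
proof (rule antisym)
  let ?H = "path_product G u n"
  let ?Q = "\<lambda>k. \<exists>W. resolving_set ?H W \<and> card W = k"
  have "pverts G \<noteq> {}" using assms(1) by auto
  then have exP: "?P (card (pverts G))" using resolving_fibres_pverts by blast
  obtain S where S: "resolving_fibres n S" "card S = (LEAST k. ?P k)"
    using LeastI[of ?P, OF exP] by blast
  have farQ: "?Q (card S)"
    using resolving_fibres_far_ends[OF assms(2) S(1)]
    by (intro exI[of _ "S \<times> {n - 1}"]) (simp add: card_cartesian_product)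
  then show "metric_dim ?H \<le> (LEAST k. ?P k)"
    unfolding metric_dim_def S(2)[symmetric] by (rule Least_le)
  obtain W where W: "resolving_set ?H W" "card W = metric_dim ?H"
    using LeastI[of ?Q, OF farQ] unfolding metric_dim_def by blast
  have "(LEAST k. ?P k) \<le> card (fst ` W)"
    using resolving_set_fibres[OF assms W(1)] by (intro Least_le) blast
  also have "\<dots> \<le> card W"
  proof (rule card_image_le)
    have "W \<subseteq> pverts G \<times> {..<n}"
      using W(1) unfolding resolving_set_def pverts_path_product by blast
    then show "finite W" using pair_finite_verts finite_subset by blast
  qed
  finally show "(LEAST k. ?P k) \<le> metric_dim ?H" using W(2) by simp
qed

section \<open>Growing the path\<close>

lemma resolving_fibres_antimono:
  assumes "m \<le> n" "resolving_fibres n S"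
  shows "resolving_fibres m S"
  using assms unfolding resolving_fibres_def by (meson order_less_le_trans)

text \<open>
  Lowering both heights by \<open>1\<close> does not change the comparison, so only the heights \<open>n\<close> and \<open>0\<close>
  are new; they would need two distances from \<open>{1..diameter G}\<close> that differ by \<open>n\<close>.
\<close>

lemma resolving_fibres_Suc:
  assumes "diameter G \<le> n" "resolving_fibres n S"
  shows "resolving_fibres (Suc n) S"
proof -
  note S = assms(2)[unfolded resolving_fibres_def]
  have resolved: "\<exists>s\<in>S. gdist G a s + i \<noteq> gdist G b s + j"
    if ab: "a \<in> pverts G - S" "b \<in> pverts G - S" "a \<noteq> b" and ij: "i < Suc n" "j < Suc n"
    for a b i j
  proof (cases "0 < i \<and> 0 < j")
    case True
    then have "i - 1 < n" "j - 1 < n" using ij by auto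
    then obtain s where "s \<in> S" "gdist G a s + (i - 1) \<noteq> gdist G b s + (j - 1)"
      using S ab by blast
    then show ?thesis using True by (intro bexI[of _ s]) auto
  next
    case False
    show ?thesis
    proof (cases "i < n \<and> j < n")
      case True
      then show ?thesis using S ab by blast
    next
      case extreme: False
      obtain s where s: "s \<in> S" using S by blast
      have "x \<in> pverts G - S \<Longrightarrow> 0 < gdist G x s \<and> gdist G x s \<le> n" for x
        using gdist_pos[OF wf reachable_in, of x s] gdist_le_diameter[of G x s] assms(1) s S
          pair_finite_verts by fastforce
      from this[of a] this[of b] show ?thesis
        using ab ij s False extreme by (intro bexI[of _ s]) auto
    qed
  qed
  show ?thesis unfolding resolving_fibres_def
    using S by (intro conjI ballI impI allI resolved) blast+
qed

lemma metric_dim_product_mono: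
  assumes "2 \<le> card (pverts G)" "1 \<le> m" "m \<le> n"
  shows "metric_dim (path_product G u m) \<le> metric_dim (path_product G u n)"
proof -
  have "pverts G \<noteq> {}" using assms(1) by auto
  then obtain S where "resolving_fibres n S"
    "card S = (LEAST k. \<exists>S. resolving_fibres n S \<and> card S = k)"
    using LeastI[of "\<lambda>k. \<exists>S. resolving_fibres n S \<and> card S = k"] resolving_fibres_pverts by blast
  moreover from this assms(3) have
    "(LEAST k. \<exists>S. resolving_fibres m S \<and> card S = k) \<le> card S"
    using resolving_fibres_antimono by (intro Least_le) blast
  ultimately show ?thesis using assms by (simp add: metric_dim_product_eq_Least)
qed

lemma metric_dim_product_stable:
  assumes "2 \<le> card (pverts G)" "1 \<le> n" "diameter G \<le> n"
  shows "metric_dim (path_product G u n) = metric_dim (path_product G u (Suc n))"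
proof -
  have "resolving_fibres n = resolving_fibres (Suc n)"
    using resolving_fibres_Suc[OF assms(3)] resolving_fibres_antimono[of n "Suc n"] by auto
  then show ?thesis
    using assms(1,2) by (simp add: metric_dim_product_eq_Least)
qed

lemma diameter_pos:
  assumes "2 \<le> card (pverts G)"
  shows "1 \<le> diameter G"
proof -
  obtain a b where "a \<in> pverts G" "b \<in> pverts G" "a \<noteq> b"
    using assms by (auto simp: numeral_2_eq_2 card_le_Suc_iff)
  then show ?thesis
    using gdist_pos[OF wf reachable_in, of a b] gdist_le_diameter[of G a b] pair_finite_verts
    by fastforce
qed

end

theorem proposition2p10:
  fixes G :: "'a pair_pre_digraph" and u :: 'a and d :: nat
  assumes "pair_graph G"
    and "Digraph_Component.connected (with_proj G)"
    and "2 \<le> card (pverts G)"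
    and "u \<in> pverts G"
    and "d = diameter G"
  shows "(\<forall>n. 1 \<le> n \<and> n \<le> d - 1 \<longrightarrow>
            rooted_metric_dim ((G, u) \<sqinter>\<^sub>h (path_graph n, 0))
              \<le> rooted_metric_dim ((G, u) \<sqinter>\<^sub>h (path_graph (n + 1), 0))) \<and>
         (\<forall>n. n \<ge> d \<longrightarrow>
            rooted_metric_dim ((G, u) \<sqinter>\<^sub>h (path_graph n, 0))
              = rooted_metric_dim ((G, u) \<sqinter>\<^sub>h (path_graph (n + 1), 0)))"
proof -
  interpret connected_pair_graph G
    using assms(1,2) by (intro connected_pair_graph.intro connected_pair_graph_axioms.intro)
  have "metric_dim (path_product G u n) \<le> metric_dim (path_product G u (n + 1))" if "1 \<le> n" for n
    using metric_dim_product_mono[OF assms(3) that] by simp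
  moreover have "metric_dim (path_product G u n) = metric_dim (path_product G u (n + 1))"
    if "d \<le> n" for n
    using metric_dim_product_stable[OF assms(3), of n u] diameter_pos[OF assms(3)] assms(5) that
    by simp
  ultimately show ?thesis unfolding rooted_metric_dim_def by blast
qed

end
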